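(* Let $N\in\mathbb{R}^{n\times m}$ with $n\le m$, and let $g:\mathbb{R}^{n\times m}\to\mathbb{R}\cup\{\infty\}$ be a closed proper convex function. Then for all $r\in\{1,\dots,n\}$ such that there is a matrix $M$ with $\mathrm{rank}(M)\le r$ and $g(M)<\infty$: $$\min_{\substack{M\in\mathbb{R}^{n\times m}\\ \mathrm{rank}(M)\le r}}\left[\tfrac12\|N-M\|_F^2+g(M)\right]\;\ge\;-\min_{D\in\mathbb{R}^{n\times m}}\left[g^\ast(-D)+\tfrac12\|N+D\|_r^2-\tfrac12\|N\|_F^2\right]$$ and $$-\min_{D\in\mathbb{R}^{n\times m}}\left[g^\ast(-D)+\tfrac12\|N+D\|_r^2-\tfrac12\|N\|_F^2\right]=\min_{M\in\mathbb{R}^{n\times m}}\left[\tfrac12\|M\|_{r\ast}^2-\langle N,M\rangle+\tfrac12\|N\|_F^2+g(M)\right].$$ Moreover, if the problem $\min_{M\in\mathbb{R}^{n\times m}}\left[\tfrac12\|M\|_{r\ast}^2-\langle N,M\rangle+\tfrac12\|N\|_F^2+g(M)\right]$ has a minimizer $M^\star$ with $\mathrm{rank}(M^\star)\le r$, then $$\operatorname*{argmin}_{\substack{M\in\mathbb{R}^{n\times m}\\ \mathrm{rank}(M)\le r}}\left[\tfrac12\|N-M\|_F^2+g(M)\right]\;\subset\;\operatorname*{argmin}_{M\in\mathbb{R}^{n\times m}}\left[\tfrac12\|M\|_{r\ast}^2-\langle N,M\rangle+\tfrac12\|N\|_F^2+g(M)\right].$$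
   Context: Matrices are real, $n\times m$ with $n\le m$; $\sigma_1(X)\ge\dots\ge\sigma_n(X)\ge 0$ are the singular values of $X$ counted with multiplicity. $\langle X,Y\rangle=\mathrm{trace}(X^{\mathsf T}Y)$ and $\|\cdot\|_F$ is the Frobenius norm. For $r\in\{1,\dots,n\}$, $\|M\|_r:=\sqrt{\sum_{i=1}^r\sigma_i^2(M)}$, and $\|M\|_{r\ast}:=\max_{\|X\|_r\le1}\langle M,X\rangle$ is its dual norm. A function is closed, proper, convex if its epigraph is closed, non-empty, convex respectively. The conjugate is $g^\ast(D):=\sup_{M}[\langle D,M\rangle-g(M)]$. $\operatorname{argmin}$ denotes the set of minimizers. *)

theory Defs
  imports "HOL-Analysis.Analysis" "HOL-Library.Multiset"
begin

text \<open>
  A real \<open>n \<times> m\<close> matrix has type \<^typ>\<open>real ^ 'm ^ 'n\<close>.  On this type the inner product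
  \<open>(\<bullet>)\<close> of the library is \<open>\<langle>X, Y\<rangle> = trace (X\<^sup>T Y)\<close>, and \<open>norm\<close> is the Frobenius norm.
\<close>

lemma inner_matrix_eq_trace:
  fixes X Y :: "real ^ 'm ^ 'n"
  shows "X \<bullet> Y = trace (transpose X ** Y)"
  unfolding trace_def inner_vec_def matrix_matrix_mult_def transpose_def
  by (simp add: sum.swap[of _ "UNIV :: 'n set"])

lemma norm_matrix_eq_Frobenius:
  fixes X :: "real ^ 'm ^ 'n"
  shows "norm X = sqrt (\<Sum>i\<in>UNIV. \<Sum>j\<in>UNIV. (X $ i $ j)\<^sup>2)"
  by (simp add: norm_eq_sqrt_inner inner_vec_def power2_eq_square)

text \<open>
  The singular values are the \<open>s \<ge> 0\<close> for which \<open>s\<^sup>2\<close> is an eigenvalue of \<open>X X\<^sup>T\<close>.  As \<open>X X\<^sup>T\<close>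
  is symmetric, the multiplicity of an eigenvalue is the dimension of its eigenspace.  The
  multiset below has \<open>n\<close> elements, the number of singular values of an \<open>n \<times> m\<close> matrix
  when \<open>n \<le> m\<close>.
\<close>

definition left_singular_space :: "real ^ 'm ^ 'n \<Rightarrow> real \<Rightarrow> (real ^ 'n) set" where
  "left_singular_space X s = {u. (X ** transpose X) *v u = s\<^sup>2 *\<^sub>R u}"

definition singular_values :: "real ^ 'm ^ 'n \<Rightarrow> real multiset" where
  "singular_values X =
     (\<Sum>s\<in>{s. 0 \<le> s \<and> left_singular_space X s \<noteq> {0}}.
        replicate_mset (dim (left_singular_space X s)) s)"

definition singular_value :: "nat \<Rightarrow> real ^ 'm ^ 'n \<Rightarrow> real" where
  "singular_value i X = rev (sorted_list_of_multiset (singular_values X)) ! (i - 1)"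

definition r_norm :: "nat \<Rightarrow> real ^ 'm ^ 'n \<Rightarrow> real" where
  "r_norm r M = sqrt (\<Sum>i=1..r. (singular_value i M)\<^sup>2)"

text \<open>For \<open>1 \<le> r \<le> n \<le> m\<close> the supremum is over a compact set, so it is a maximum.\<close>

definition r_dual_norm :: "nat \<Rightarrow> real ^ 'm ^ 'n \<Rightarrow> real" where
  "r_dual_norm r M = (SUP X\<in>{X. r_norm r X \<le> 1}. M \<bullet> X)"

definition ereal_epigraph :: "('a \<Rightarrow> ereal) \<Rightarrow> ('a \<times> real) set" where
  "ereal_epigraph g = {(x, t). g x \<le> ereal t}"

definition closed_proper_convex :: "('a :: real_normed_vector \<Rightarrow> ereal) \<Rightarrow> bool" where
  "closed_proper_convex g \<longleftrightarrow>
     closed (ereal_epigraph g) \<and> ereal_epigraph g \<noteq> {} \<and> convex (ereal_epigraph g)"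

definition conjugate :: "('a :: real_inner \<Rightarrow> ereal) \<Rightarrow> 'a \<Rightarrow> ereal" where
  "conjugate g d = (SUP x. ereal (d \<bullet> x) - g x)"

definition argmin_on :: "('a \<Rightarrow> ereal) \<Rightarrow> 'a set \<Rightarrow> 'a set" where
  "argmin_on f S = {x. is_arg_min f (\<lambda>x. x \<in> S) x}"

definition is_min_on :: "('a \<Rightarrow> ereal) \<Rightarrow> 'a set \<Rightarrow> ereal \<Rightarrow> bool" where
  "is_min_on f S v \<longleftrightarrow> v \<in> f ` argmin_on f S"

definition rank_objective ::
    "real ^ 'm ^ 'n \<Rightarrow> (real ^ 'm ^ 'n \<Rightarrow> ereal) \<Rightarrow> real ^ 'm ^ 'n \<Rightarrow> ereal" where
  "rank_objective N g M = ereal (1/2 * (norm (N - M))\<^sup>2) + g M"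

definition dual_objective ::
    "nat \<Rightarrow> real ^ 'm ^ 'n \<Rightarrow> (real ^ 'm ^ 'n \<Rightarrow> ereal) \<Rightarrow> real ^ 'm ^ 'n \<Rightarrow> ereal" where
  "dual_objective r N g D =
     conjugate g (- D) + ereal (1/2 * (r_norm r (N + D))\<^sup>2 - 1/2 * (norm N)\<^sup>2)"

definition relaxed_objective ::
    "nat \<Rightarrow> real ^ 'm ^ 'n \<Rightarrow> (real ^ 'm ^ 'n \<Rightarrow> ereal) \<Rightarrow> real ^ 'm ^ 'n \<Rightarrow> ereal" where
  "relaxed_objective r N g M =
     ereal (1/2 * (r_dual_norm r M)\<^sup>2 - N \<bullet> M + 1/2 * (norm N)\<^sup>2) + g M"

end

theory Submission
  imports Defs
begin

text \<open>
  Write \<open>K\<close> for the compact set of all matrices of rank at most \<open>r\<close> and Frobenius norm at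
  most \<open>1\<close>.  Everything rests on one fact: the \<open>r\<close>-norm is the support function of \<open>K\<close>,
  \<open>\<parallel>X\<parallel>\<^sub>r = max {\<langle>X, Y\<rangle> | Y \<in> K}\<close>
  (lemmas \<open>inner_le_r_norm\<close> and \<open>r_norm_attained\<close>).  This is Ky Fan's maximum principle for
  \<open>X X\<^sup>T\<close>.  It is derived from an orthonormal eigenbasis of \<open>X X\<^sup>T\<close>, which also turns the
  multiset of singular values into a decreasing list indexed by that basis.

  Consequences of the support formula:
  \<^item> \<open>\<parallel>\<cdot>\<parallel>\<^sub>r\<close> is a continuous norm dominated by the Frobenius norm, its dual norm dominates the
    Frobenius norm, and the dual norm equals the Frobenius norm on matrices of rank at most \<open>r\<close>.
    Hence the relaxed objective and the original one coincide on these matrices, which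
    gives the inequality between the minima and the inclusion of the argmin sets.
  \<^item> \<open>rank M \<le> r\<close> holds exactly when the Frobenius norm of \<open>M\<close> is at most \<open>\<parallel>M\<parallel>\<^sub>r\<close>, because
    equality in Cauchy-Schwarz makes \<open>M\<close> a multiple of a member of \<open>K\<close>.  So the rank
    constraint is closed, and both primal problems, being coercive and lower
    semicontinuous, have minimizers (\<open>coercive_minimizer_exists\<close>).

  The equality of the relaxed and the dual value is Fenchel duality.  Weak duality is
  \<open>\<langle>M, X\<rangle> \<le> \<parallel>M\<parallel>\<^sub>r\<^sub>* \<parallel>X\<parallel>\<^sub>r \<le> (\<parallel>M\<parallel>\<^sub>r\<^sub>*\<^sup>2 + \<parallel>X\<parallel>\<^sub>r\<^sup>2) / 2\<close>.  For the converse, the minimal relaxed value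
  \<open>v\<close> allows a hyperplane to separate the epigraph of \<open>g\<close> from the strict hypograph of \<open>v - f\<close>,
  where \<open>f\<close> is the finite convex part of the relaxed objective (\<open>fenchel_separation\<close>).  Since
  \<open>f\<close> is finite everywhere, the hyperplane is not vertical, and its slope \<open>D\<close> solves the
  dual problem.  To bound the dual objective at \<open>D\<close> it suffices to evaluate \<open>f\<close> at the
  single point \<open>\<parallel>N + D\<parallel>\<^sub>r Y\<close>, where \<open>Y \<in> K\<close> attains \<open>\<parallel>N + D\<parallel>\<^sub>r\<close>; there the dual norm
  is just the Frobenius norm.
\<close>

section \<open>Orthonormal sets\<close>

definition orthonormal :: "'a::real_inner set \<Rightarrow> bool" where
  "orthonormal B \<longleftrightarrow> (\<forall>a\<in>B. \<forall>b\<in>B. a \<bullet> b = (if a = b then 1 else 0))"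

lemma orthonormal_independent:
  assumes "orthonormal B"
  shows "independent B"
proof (rule pairwise_orthogonal_independent)
  show "pairwise orthogonal B"
    using assms by (auto simp: orthonormal_def pairwise_def orthogonal_def)
  show "0 \<notin> B"
    using assms by (fastforce simp: orthonormal_def)
qed

lemma orthonormal_finite:
  fixes B :: "'a::euclidean_space set"
  assumes "orthonormal B"
  shows "finite B"
  using orthonormal_independent[OF assms] independent_bound by blast

lemma orthonormal_basis_of_subspace:
  fixes S :: "'a::euclidean_space set"
  assumes "subspace S"
  obtains B where "orthonormal B" "span B = S" "card B = dim S"
proof -
  obtain B where B: "pairwise orthogonal B" "\<And>x. x \<in> B \<Longrightarrow> norm x = 1"
      "card B = dim S" "span B = S"
    using orthonormal_basis_subspace[OF assms] by metis
  have "orthonormal B"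
    unfolding orthonormal_def
    using B(1,2) by (auto simp: pairwise_def orthogonal_def dot_square_norm)
  then show thesis using that B by blast
qed

lemma orthonormal_inner_expand:
  fixes B :: "'a::euclidean_space set"
  assumes B: "orthonormal B" and y: "y \<in> span B"
  shows "x \<bullet> y = (\<Sum>b\<in>B. (x \<bullet> b) * (y \<bullet> b))"
proof -
  have "(\<Sum>b\<in>B. (y \<bullet> b) *\<^sub>R b) = y"
    using B by (intro orthonormal_basis_expand y orthonormal_finite)
      (auto simp: orthonormal_def pairwise_def orthogonal_def norm_eq_1)
  then have "x \<bullet> y = x \<bullet> (\<Sum>b\<in>B. (y \<bullet> b) *\<^sub>R b)" by simp
  also have "\<dots> = (\<Sum>b\<in>B. (x \<bullet> b) * (y \<bullet> b))"
    by (simp add: inner_sum_right mult.commute)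
  finally show ?thesis .
qed

text \<open>The sum is the squared norm of the orthogonal projection of \<open>x\<close> onto the span of \<open>B\<close>.\<close>
lemma bessel_inequality:
  fixes B :: "'a::euclidean_space set"
  assumes B: "orthonormal B"
  shows "(\<Sum>b\<in>B. (x \<bullet> b)\<^sup>2) \<le> (norm x)\<^sup>2"
proof -
  define y where "y = (\<Sum>b\<in>B. (x \<bullet> b) *\<^sub>R b)"
  have y: "y \<in> span B"
    unfolding y_def by (intro span_sum span_scale span_base)
  have "x \<bullet> y = (\<Sum>b\<in>B. (x \<bullet> b)\<^sup>2)"
    by (simp add: y_def inner_sum_right power2_eq_square)
  moreover have "y \<bullet> y = x \<bullet> y"
  proof -
    have "y \<bullet> b = x \<bullet> b" if "b \<in> B" for b
    proof -
      have "y \<bullet> b = (\<Sum>a\<in>B. (x \<bullet> a) * (a \<bullet> b))"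
        by (simp add: y_def inner_sum_left)
      also have "\<dots> = (\<Sum>a\<in>B. if a = b then x \<bullet> b else 0)"
        using B that by (intro sum.cong) (auto simp: orthonormal_def)
      finally show ?thesis using that orthonormal_finite[OF B] by simp
    qed
    then show ?thesis
      using orthonormal_inner_expand[OF B y, of y] orthonormal_inner_expand[OF B y, of x] by simp
  qed
  moreover have "0 \<le> (x - y) \<bullet> (x - y)" by simp
  ultimately show ?thesis
    by (simp add: inner_diff_left inner_diff_right inner_commute power2_norm_eq_inner)
qed

section \<open>Eigenbases of self-adjoint maps\<close>

text \<open>
  A maximizer \<open>u\<close> of the Rayleigh quotient \<open>x \<bullet> A x\<close> on the unit sphere of \<open>S\<close> is an eigenvector:
  with \<open>\<mu>\<close> the maximum, the quadratic form \<open>\<mu> (x \<bullet> x) - x \<bullet> A x\<close> is nonnegative on \<open>S\<close> and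
  vanishes at \<open>u\<close>, so its first-order variation at \<open>u\<close> in every direction in \<open>S\<close> is zero.
\<close>
lemma selfadjoint_eigenvector_exists:
  fixes A :: "'a::euclidean_space \<Rightarrow> 'a"
  assumes lin: "linear A" and sa: "\<And>x y. A x \<bullet> y = x \<bullet> A y"
    and S: "subspace S" "A ` S \<subseteq> S" "S \<noteq> {0}"
  obtains u \<mu> where "u \<in> S" "norm u = 1" "A u = \<mu> *\<^sub>R u"
proof -
  interpret linear A by fact
  let ?K = "S \<inter> sphere 0 1"
  have "compact ?K"
    by (intro closed_Int_compact closed_subspace S compact_sphere)
  moreover obtain w where w: "w \<in> S" "w \<noteq> 0"
    using S(1,3) subspace_0 by blast
  then have "(1 / norm w) *\<^sub>R w \<in> ?K"
    using S(1) by (simp add: subspace_scale)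
  then have "?K \<noteq> {}" by blast
  moreover have "continuous_on ?K (\<lambda>x. x \<bullet> A x)"
    by (intro continuous_intros linear_continuous_on linear_conv_bounded_linear[THEN iffD1] lin)
  ultimately obtain u where u: "u \<in> ?K" and max: "\<And>x. x \<in> ?K \<Longrightarrow> x \<bullet> A x \<le> u \<bullet> A u"
    using continuous_attains_sup by metis
  define \<mu> where "\<mu> = u \<bullet> A u"
  have nu: "norm u = 1" and uS: "u \<in> S" using u by auto
  have quad: "0 \<le> \<mu> * (x \<bullet> x) - x \<bullet> A x" if "x \<in> S" for x
  proof (cases "x = 0")
    case False
    have "(1 / norm x) *\<^sub>R x \<in> ?K"
      using False S(1) that by (simp add: subspace_scale)
    from max[OF this] have "(x \<bullet> A x) / (norm x)\<^sup>2 \<le> \<mu>"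
      by (simp add: \<mu>_def scale power2_eq_square divide_simps)
    then show ?thesis
      using False by (simp add: divide_simps power2_norm_eq_inner split: if_splits)
  qed (simp add: zero)
  \<comment> \<open>the variation in the direction \<open>v\<close> of the residual itself already forces \<open>v = 0\<close>\<close>
  have "A u - \<mu> *\<^sub>R u = 0"
  proof -
    define v where "v = A u - \<mu> *\<^sub>R u"
    have vS: "v \<in> S"
      unfolding v_def using S uS by (auto intro!: subspace_diff subspace_scale)
    define c where "c = \<mu> * (v \<bullet> v) - v \<bullet> A v"
    have ineq: "0 \<le> t\<^sup>2 * c - 2 * t * (v \<bullet> v)" for t
    proof -
      have "u + t *\<^sub>R v \<in> S" using S(1) uS vS by (simp add: subspace_add subspace_scale)
      from quad[OF this]
      have "0 \<le> \<mu> * (u \<bullet> u + 2 * t * (u \<bullet> v) + t\<^sup>2 * (v \<bullet> v))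
          - (u \<bullet> A u + t * (u \<bullet> A v) + t * (v \<bullet> A u) + t\<^sup>2 * (v \<bullet> A v))"
        by (simp add: add scale inner_simps inner_commute[of v u] power2_eq_square algebra_simps)
      moreover have "u \<bullet> A v = v \<bullet> A u" using sa[of u v] by (simp add: inner_commute)
      moreover have "v \<bullet> A u = v \<bullet> v + \<mu> * (u \<bullet> v)"
        by (simp add: v_def inner_simps inner_commute algebra_simps)
      moreover have "u \<bullet> u = 1" using nu by (simp add: dot_square_norm)
      ultimately show ?thesis by (simp add: c_def \<mu>_def algebra_simps)
    qed
    have "v \<bullet> v = 0"
    proof (rule ccontr)
      assume "v \<bullet> v \<noteq> 0"
      then have pos: "0 < v \<bullet> v" by simp
      \<comment> \<open>a step so short that the linear term of \<open>ineq\<close> dominates the quadratic one\<close>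
      define t where "t = (v \<bullet> v) / (\<bar>c\<bar> + 1)"
      have t: "0 < t" using pos by (simp add: t_def)
      have "t * c \<le> t * (\<bar>c\<bar> + 1)" using t by (intro mult_left_mono) auto
      also have "\<dots> = v \<bullet> v" by (simp add: t_def)
      finally have "t * (t * c) \<le> t * (v \<bullet> v)" using t by (intro mult_left_mono) auto
      moreover have "0 < t * (v \<bullet> v)" using t pos by simp
      ultimately show False using ineq[of t] by (simp add: power2_eq_square mult.assoc)
    qed
    then show ?thesis by (simp add: v_def)
  qed
  then show thesis using that[of u \<mu>] uS nu by simp
qed

text \<open>
  Splitting off one eigenvector \<open>u\<close> leaves the orthogonal complement of \<open>u\<close> in \<open>S\<close>, which is again
  invariant because \<open>A\<close> is self-adjoint, and has smaller dimension.
\<close>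
lemma selfadjoint_eigenbasis_exists:
  fixes A :: "'a::euclidean_space \<Rightarrow> 'a"
  assumes lin: "linear A" and sa: "\<And>x y. A x \<bullet> y = x \<bullet> A y"
    and S: "subspace S" "A ` S \<subseteq> S"
  shows "\<exists>B. orthonormal B \<and> span B = S \<and> (\<forall>b\<in>B. \<exists>\<mu>. A b = \<mu> *\<^sub>R b)"
  using S
proof (induction "dim S" arbitrary: S rule: less_induct)
  case less
  show ?case
  proof (cases "S = {0}")
    case True
    then show ?thesis by (intro exI[of _ "{}"]) (simp add: orthonormal_def)
  next
    case False
    obtain u \<mu> where u: "u \<in> S" "norm u = 1" "A u = \<mu> *\<^sub>R u"
      using selfadjoint_eigenvector_exists[OF lin sa less.prems False] by metis
    define T where "T = {x \<in> S. u \<bullet> x = 0}"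
    have T: "subspace T"
      unfolding T_def using less.prems(1)
      by (auto simp: subspace_def inner_simps)
    have inv: "A ` T \<subseteq> T"
    proof
      fix y assume "y \<in> A ` T"
      then obtain x where x: "x \<in> S" "u \<bullet> x = 0" "y = A x" by (auto simp: T_def)
      have "u \<bullet> A x = A u \<bullet> x" using sa by simp
      also have "\<dots> = 0" using x u by simp
      finally show "y \<in> T" using x less.prems(2) by (auto simp: T_def)
    qed
    have uT: "u \<notin> T" using u by (auto simp: T_def dot_square_norm)
    have "T \<subseteq> S" by (auto simp: T_def)
    then have "T \<subset> S" using uT u(1) by blast
    then have "dim T < dim S"
      using T less.prems(1) by (metis dim_psubset span_eq_iff)
    from less.hyps[OF this T inv] obtain B where B: "orthonormal B" "span B = T"
        "\<forall>b\<in>B. \<exists>\<mu>. A b = \<mu> *\<^sub>R b" by blast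
    have BT: "B \<subseteq> T" using B(2) span_superset by blast
    have "orthonormal (insert u B)"
      using B(1) BT u uT by (auto simp: orthonormal_def T_def dot_square_norm inner_commute)
    moreover have "span (insert u B) = S"
    proof
      show "span (insert u B) \<subseteq> S"
        using BT u less.prems(1) by (intro span_minimal) (auto simp: T_def)
      show "S \<subseteq> span (insert u B)"
      proof
        fix x assume x: "x \<in> S"
        have "x - (u \<bullet> x) *\<^sub>R u \<in> T"
          using x u less.prems(1)
          by (auto simp: T_def inner_simps dot_square_norm intro!: subspace_diff subspace_scale)
        then show "x \<in> span (insert u B)"
          using B(2) by (auto simp: span_insert)
      qed
    qed
    ultimately show ?thesis
      using B(3) u(3) by (intro exI[of _ "insert u B"]) auto
  qed
qed

section \<open>Singular values and eigenbases\<close>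

lemma inner_eq_sum_columns:
  fixes X Y :: "real ^ 'm ^ 'n"
  shows "X \<bullet> Y = (\<Sum>j\<in>UNIV. column j X \<bullet> column j Y)"
  unfolding inner_vec_def column_def by (simp add: sum.swap[of _ "UNIV :: 'n set"])

text \<open>
  An orthonormal basis of the column space of \<open>Y\<close> can replace the standard basis in
  \<open>\<langle>X, Y\<rangle> = \<Sum>\<^sub>i (row\<^sub>i X) \<bullet> (row\<^sub>i Y)\<close>, even when \<open>X\<close> has a larger column space.
\<close>
lemma inner_matrix_eq_sum_rows:
  fixes X Y :: "real ^ 'm ^ 'n"
  assumes Q: "orthonormal Q" and Y: "range ((*v) Y) \<subseteq> span Q"
  shows "X \<bullet> Y = (\<Sum>q\<in>Q. (q v* X) \<bullet> (q v* Y))"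
proof -
  have nth: "(q v* Z) $ j = column j Z \<bullet> q" for q and Z :: "real ^ 'm ^ 'n" and j
    by (simp add: vector_matrix_mult_def column_def inner_vec_def mult.commute)
  have col: "column j Y \<in> span Q" for j
    using Y by (metis matrix_vector_mul_component matrix_vector_mult_basis range_subsetD)
  have "X \<bullet> Y = (\<Sum>j\<in>UNIV. \<Sum>q\<in>Q. (column j X \<bullet> q) * (column j Y \<bullet> q))"
    unfolding inner_eq_sum_columns
    by (intro sum.cong refl orthonormal_inner_expand[OF Q col])
  also have "\<dots> = (\<Sum>q\<in>Q. \<Sum>j\<in>UNIV. (column j X \<bullet> q) * (column j Y \<bullet> q))"
    by (rule sum.swap)
  also have "\<dots> = (\<Sum>q\<in>Q. (q v* X) \<bullet> (q v* Y))"
    by (simp add: inner_vec_def[of "_ v* _"] nth)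
  finally show ?thesis .
qed

lemma inner_gram:
  fixes X :: "real ^ 'm ^ 'n"
  shows "u \<bullet> ((X ** transpose X) *v w) = (u v* X) \<bullet> (w v* X)"
  by (simp add: matrix_vector_mul_assoc[symmetric] dot_lmul_matrix[symmetric])

text \<open>
  Coefficients of an eigenvector on basis vectors with a different eigenvalue vanish.  The
  signs matter: on nonnegative numbers, equal squares mean equal values of \<open>\<sigma>\<close>.
\<close>
lemma left_singular_space_eq_span:
  fixes X :: "real ^ 'm ^ 'n"
  assumes B: "orthonormal B" "span B = UNIV"
    and eig: "\<And>b. b \<in> B \<Longrightarrow> (X ** transpose X) *v b = (\<sigma> b)\<^sup>2 *\<^sub>R b"
    and nonneg: "\<And>b. b \<in> B \<Longrightarrow> 0 \<le> \<sigma> b" and s: "0 \<le> s"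
  shows "left_singular_space X s = span {b \<in> B. \<sigma> b = s}"
proof
  show "span {b \<in> B. \<sigma> b = s} \<subseteq> left_singular_space X s"
  proof (rule span_minimal)
    show "subspace (left_singular_space X s)"
      by (auto simp: subspace_def left_singular_space_def matrix_vector_right_distrib
          scaleR_right_distrib matrix_vector_mult_scaleR)
  qed (auto simp: left_singular_space_def eig)
next
  show "left_singular_space X s \<subseteq> span {b \<in> B. \<sigma> b = s}"
  proof
    fix u assume "u \<in> left_singular_space X s"
    then have u: "(X ** transpose X) *v u = s\<^sup>2 *\<^sub>R u" by (simp add: left_singular_space_def)
    have zero: "u \<bullet> b = 0" if "b \<in> B" "\<sigma> b \<noteq> s" for b
    proof -
      have "s\<^sup>2 * (u \<bullet> b) = b \<bullet> ((X ** transpose X) *v u)" by (simp add: u inner_commute)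
      also have "\<dots> = u \<bullet> ((X ** transpose X) *v b)" by (simp only: inner_gram inner_commute)
      also have "\<dots> = (\<sigma> b)\<^sup>2 * (u \<bullet> b)" by (simp add: eig[OF that(1)])
      finally have "s\<^sup>2 = (\<sigma> b)\<^sup>2 \<or> u \<bullet> b = 0" by auto
      then show ?thesis using that s nonneg[OF that(1)] by (auto simp: power2_eq_iff_nonneg)
    qed
    have "u = (\<Sum>b\<in>B. (u \<bullet> b) *\<^sub>R b)"
      using B by (intro orthonormal_basis_expand[symmetric] orthonormal_finite)
        (auto simp: orthonormal_def pairwise_def orthogonal_def norm_eq_1)
    also have "\<dots> \<in> span {b \<in> B. \<sigma> b = s}"
    proof (rule span_sum)
      fix b assume b: "b \<in> B"
      show "(u \<bullet> b) *\<^sub>R b \<in> span {b \<in> B. \<sigma> b = s}"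
        using b zero[OF b] by (cases "\<sigma> b = s") (auto intro: span_scale span_base simp: span_0)
    qed
    finally show "u \<in> span {b \<in> B. \<sigma> b = s}" .
  qed
qed

text \<open>
  The multiplicity of \<open>s\<close> is the dimension of its eigenspace, hence the number of basis
  vectors with \<open>\<sigma> b = s\<close>.
\<close>
lemma singular_values_eq_image_mset:
  fixes X :: "real ^ 'm ^ 'n"
  assumes B: "orthonormal B" "span B = UNIV"
    and eig: "\<And>b. b \<in> B \<Longrightarrow> (X ** transpose X) *v b = (\<sigma> b)\<^sup>2 *\<^sub>R b"
    and nonneg: "\<And>b. b \<in> B \<Longrightarrow> 0 \<le> \<sigma> b"
  shows "singular_values X = image_mset \<sigma> (mset_set B)"
proof (rule multiset_eqI)
  fix t
  have space: "left_singular_space X s = span {b \<in> B. \<sigma> b = s}" if "0 \<le> s" for s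
    by (rule left_singular_space_eq_span) (use B eig nonneg that in auto)
  have fin: "finite B" using orthonormal_finite B(1) .
  have dim: "dim (left_singular_space X s) = card {b \<in> B. \<sigma> b = s}" if "0 \<le> s" for s
  proof -
    have "orthonormal {b \<in> B. \<sigma> b = s}" using B(1) by (auto simp: orthonormal_def)
    then show ?thesis
      using space[OF that] by (simp add: dim_eq_card_independent orthonormal_independent)
  qed
  let ?S = "{s. 0 \<le> s \<and> left_singular_space X s \<noteq> {0}}"
  have "?S \<subseteq> \<sigma> ` B"
  proof
    fix s assume "s \<in> ?S"
    then have "span {b \<in> B. \<sigma> b = s} \<noteq> {0}" using space[of s] by simp
    then have "{b \<in> B. \<sigma> b = s} \<noteq> {}" using span_empty by metis
    then show "s \<in> \<sigma> ` B" by auto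
  qed
  then have finS: "finite ?S" using fin finite_surj by blast
  have "count (singular_values X) t
      = (\<Sum>s\<in>?S. count (replicate_mset (dim (left_singular_space X s)) s) t)"
    unfolding singular_values_def by (rule count_sum)
  also have "\<dots> = (\<Sum>s\<in>?S. if s = t then dim (left_singular_space X t) else 0)"
    by (intro sum.cong) auto
  also have "\<dots> = (if t \<in> ?S then dim (left_singular_space X t) else 0)"
    using finS by simp
  also have "\<dots> = card {b \<in> B. \<sigma> b = t}"
  proof (cases "0 \<le> t")
    case True
    then show ?thesis
      using dim[OF True] by (cases "left_singular_space X t = {0}") auto
  next
    case False
    then have "{b \<in> B. \<sigma> b = t} = {}" using nonneg by auto
    then have "card {b \<in> B. \<sigma> b = t} = 0" by (simp only: card.empty)
    then show ?thesis using False by simp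
  qed
  also have "\<dots> = count (image_mset \<sigma> (mset_set B)) t"
    using fin by (simp add: count_image_mset_eq_card_vimage)
  finally show "count (singular_values X) t = count (image_mset \<sigma> (mset_set B)) t" .
qed

text \<open>
  The eigenbasis, listed by decreasing eigenvalue, gives access to \<open>singular_value\<close>
  without going through the sorted multiset.  Positions in the list start at \<open>0\<close>, indices of
  singular values at \<open>1\<close>.
\<close>
lemma left_singular_basis_exists:
  fixes X :: "real ^ 'm ^ 'n"
  obtains bs where "distinct bs" "orthonormal (set bs)" "span (set bs) = UNIV"
    "length bs = CARD('n)"
    "\<And>i. i < CARD('n) \<Longrightarrow>
       (X ** transpose X) *v (bs ! i) = (singular_value (Suc i) X)\<^sup>2 *\<^sub>R (bs ! i)"
    "\<And>i j. i \<le> j \<Longrightarrow> j < CARD('n) \<Longrightarrow> singular_value (Suc j) X \<le> singular_value (Suc i) X"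
    "\<And>i. i < CARD('n) \<Longrightarrow> 0 \<le> singular_value (Suc i) X"
proof -
  let ?A = "\<lambda>u. (X ** transpose X) *v u"
  have sa: "?A x \<bullet> y = x \<bullet> ?A y" for x y
    by (simp only: inner_gram inner_commute[of "?A x"] inner_commute)
  obtain B where B: "orthonormal B" "span B = UNIV" and ev: "\<forall>b\<in>B. \<exists>\<mu>. ?A b = \<mu> *\<^sub>R b"
    using selfadjoint_eigenbasis_exists[of ?A UNIV, OF matrix_vector_mul_linear sa] by auto
  define \<sigma> where "\<sigma> b = norm (b v* X)" for b
  have eig: "?A b = (\<sigma> b)\<^sup>2 *\<^sub>R b" if b: "b \<in> B" for b
  proof -
    obtain \<mu> where \<mu>: "?A b = \<mu> *\<^sub>R b" using ev b by blast
    have "b \<bullet> b = 1" using B(1) b by (auto simp: orthonormal_def)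
    then have "\<mu> = b \<bullet> ?A b" unfolding \<mu> by simp
    also have "\<dots> = (\<sigma> b)\<^sup>2" unfolding inner_gram \<sigma>_def power2_norm_eq_inner ..
    finally show ?thesis by (simp only: \<mu>)
  qed
  have fin: "finite B" using orthonormal_finite B(1) .
  obtain xs where xs: "set xs = B" "distinct xs" using finite_distinct_list[OF fin] by blast
  define bs where "bs = rev (sort_key \<sigma> xs)"
  have bs: "set bs = B" "distinct bs" by (auto simp: bs_def xs)
  have len: "length bs = CARD('n)"
    using bs B orthonormal_independent[OF B(1)]
    by (metis dim_UNIV dim_span_eq_card_independent DIM_cart DIM_real distinct_card mult.right_neutral)
  have "sorted_list_of_multiset (singular_values X) = rev (map \<sigma> bs)"
  proof -
    have "singular_values X = image_mset \<sigma> (mset_set B)"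
      by (rule singular_values_eq_image_mset) (use B eig in \<open>auto simp: \<sigma>_def\<close>)
    also have "\<dots> = mset (rev (map \<sigma> bs))"
      using mset_set_set[OF bs(2)] bs(1) by simp
    finally have "singular_values X = mset (rev (map \<sigma> bs))" .
    then have "sorted_list_of_multiset (singular_values X) = sort (rev (map \<sigma> bs))"
      by (simp only: sorted_list_of_multiset_mset)
    moreover have "sorted (rev (map \<sigma> bs))" by (simp add: bs_def rev_map)
    ultimately show ?thesis by (simp only: sorted_sort_id)
  qed
  then have sv: "singular_value (Suc i) X = \<sigma> (bs ! i)" if "i < CARD('n)" for i
    using that len by (simp add: singular_value_def)
  have "sorted (rev (map \<sigma> bs))" by (simp add: bs_def rev_map)
  then have dec: "\<sigma> (bs ! j) \<le> \<sigma> (bs ! i)" if "i \<le> j" "j < CARD('n)" for i j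
    using that len by (auto simp: sorted_rev_iff_nth_mono)
  show thesis
    by (rule that[of bs]) (use bs B len sv dec eig in \<open>auto simp: \<sigma>_def\<close>)
qed

section \<open>The r-norm as a support function\<close>

text \<open>
  The linear programme behind Ky Fan's principle: a total weight of \<open>r\<close>, at most \<open>1\<close> per
  index, is best spent on the \<open>r\<close> largest values.  Subtracting the threshold \<open>c\<close>, the
  \<open>r\<close>-th largest value, makes the optimal choice evident index by index.
\<close>
lemma sum_weighted_le_sum_largest:
  fixes \<mu> w :: "nat \<Rightarrow> real"
  assumes dec: "\<And>i j. i \<le> j \<Longrightarrow> j < n \<Longrightarrow> \<mu> j \<le> \<mu> i"
    and nonneg: "\<And>i. i < n \<Longrightarrow> 0 \<le> \<mu> i"
    and w: "\<And>i. i < n \<Longrightarrow> 0 \<le> w i" "\<And>i. i < n \<Longrightarrow> w i \<le> 1"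
    and total: "(\<Sum>i<n. w i) \<le> real r" and r: "1 \<le> r" "r \<le> n"
  shows "(\<Sum>i<n. \<mu> i * w i) \<le> (\<Sum>i<r. \<mu> i)"
proof -
  define c where "c = \<mu> (r - 1)"
  have c: "0 \<le> c" unfolding c_def using r by (intro nonneg) simp
  have "(\<mu> i - c) * w i \<le> (if i < r then \<mu> i - c else 0)" if "i < n" for i
  proof (cases "i < r")
    case True
    then have "0 \<le> \<mu> i - c" using dec[of i "r - 1"] r by (simp add: c_def)
    then have "(\<mu> i - c) * w i \<le> (\<mu> i - c) * 1" by (intro mult_left_mono w that)
    then show ?thesis using True by simp
  next
    case False
    then have "\<mu> i - c \<le> 0" using dec[of "r - 1" i] that by (simp add: c_def)
    then show ?thesis using False w(1)[OF that] by (simp add: mult_nonpos_nonneg)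
  qed
  then have "(\<Sum>i<n. (\<mu> i - c) * w i) \<le> (\<Sum>i<n. if i < r then \<mu> i - c else 0)"
    by (intro sum_mono) simp
  also have "\<dots> = (\<Sum>i<r. \<mu> i - c)"
    using r by (intro sum.mono_neutral_cong_right) auto
  also have "\<dots> = (\<Sum>i<r. \<mu> i) - c * real r" by (simp add: sum_subtractf)
  finally have "(\<Sum>i<n. (\<mu> i - c) * w i) \<le> (\<Sum>i<r. \<mu> i) - c * real r" .
  moreover have "c * (\<Sum>i<n. w i) \<le> c * real r" using total c by (rule mult_left_mono)
  ultimately show ?thesis
    by (simp add: left_diff_distrib sum_subtractf sum_distrib_left[symmetric])
qed

lemma r_norm_sq:
  fixes X :: "real ^ 'm ^ 'n"
  shows "(r_norm r X)\<^sup>2 = (\<Sum>i<r. (singular_value (Suc i) X)\<^sup>2)"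
proof -
  have "(\<Sum>i=1..r. (singular_value i X)\<^sup>2) = (\<Sum>i<r. (singular_value (Suc i) X)\<^sup>2)"
    by (rule sum.reindex_bij_witness[of _ Suc "\<lambda>i. i - 1"]) auto
  then show ?thesis by (simp add: r_norm_def sum_nonneg)
qed

lemma r_norm_nonneg: "0 \<le> r_norm r X"
  by (simp add: r_norm_def sum_nonneg)

text \<open>
  Ky Fan's inequality.  In the eigenbasis the left side is \<open>\<Sum>\<^sub>i \<mu>\<^sub>i w\<^sub>i\<close>, where
  \<open>w\<^sub>i\<close> is the squared length of the projection of the \<open>i\<close>-th basis vector onto the span of
  \<open>Q\<close>.  Bessel's inequality bounds each weight by \<open>1\<close> and their total by the size of \<open>Q\<close>.
\<close>
lemma sum_norm_rows_le_r_norm: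
  fixes X :: "real ^ 'm ^ 'n"
  assumes Q: "orthonormal Q" "card Q \<le> r" and r: "r \<in> {1..CARD('n)}"
  shows "(\<Sum>q\<in>Q. (norm (q v* X))\<^sup>2) \<le> (r_norm r X)\<^sup>2"
proof -
  obtain bs where bs: "distinct bs" "orthonormal (set bs)" "span (set bs) = UNIV"
    and len: "length bs = CARD('n)"
    and eig: "\<And>i. i < CARD('n) \<Longrightarrow>
       (X ** transpose X) *v (bs ! i) = (singular_value (Suc i) X)\<^sup>2 *\<^sub>R (bs ! i)"
    and dec: "\<And>i j. i \<le> j \<Longrightarrow> j < CARD('n) \<Longrightarrow> singular_value (Suc j) X \<le> singular_value (Suc i) X"
    and nonneg: "\<And>i. i < CARD('n) \<Longrightarrow> 0 \<le> singular_value (Suc i) X"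
    by (rule left_singular_basis_exists[of X]) blast
  define \<mu> where "\<mu> i = (singular_value (Suc i) X)\<^sup>2" for i
  define w where "w i = (\<Sum>q\<in>Q. (q \<bullet> bs ! i)\<^sup>2)" for i
  have reindex: "(\<Sum>b\<in>set bs. f b) = (\<Sum>i<CARD('n). f (bs ! i))" for f :: "real ^ 'n \<Rightarrow> real"
    using bs(1) len by (simp add: sum.distinct_set_conv_list sum_list_sum_nth atLeast0LessThan)
  have row: "(norm (q v* X))\<^sup>2 = (\<Sum>i<CARD('n). \<mu> i * (q \<bullet> bs ! i)\<^sup>2)" for q
  proof -
    let ?Aq = "(X ** transpose X) *v q"
    have "(norm (q v* X))\<^sup>2 = ?Aq \<bullet> q"
      by (simp only: power2_norm_eq_inner inner_gram[symmetric] inner_commute)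
    also have "\<dots> = (\<Sum>b\<in>set bs. (?Aq \<bullet> b) * (q \<bullet> b))"
      by (rule orthonormal_inner_expand) (use bs in auto)
    also have "\<dots> = (\<Sum>i<CARD('n). (?Aq \<bullet> bs ! i) * (q \<bullet> bs ! i))"
      by (rule reindex)
    also have "\<dots> = (\<Sum>i<CARD('n). \<mu> i * (q \<bullet> bs ! i)\<^sup>2)"
    proof (rule sum.cong)
      fix i assume "i \<in> {..<CARD('n)}"
      then have i: "i < CARD('n)" by simp
      have "?Aq \<bullet> bs ! i = q \<bullet> ((X ** transpose X) *v (bs ! i))"
        by (simp only: inner_commute[of ?Aq] inner_gram inner_commute)
      then show "(?Aq \<bullet> bs ! i) * (q \<bullet> bs ! i) = \<mu> i * (q \<bullet> bs ! i)\<^sup>2"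
        by (simp add: eig[OF i] \<mu>_def power2_eq_square)
    qed simp
    finally show ?thesis .
  qed
  have "(\<Sum>q\<in>Q. (norm (q v* X))\<^sup>2) = (\<Sum>i<CARD('n). \<mu> i * w i)"
    unfolding row w_def sum_distrib_left by (rule sum.swap)
  also have "\<dots> \<le> (\<Sum>i<r. \<mu> i)"
  proof (rule sum_weighted_le_sum_largest)
    fix i assume i: "i < CARD('n)"
    have "w i \<le> (norm (bs ! i))\<^sup>2"
      using bessel_inequality[OF Q(1), of "bs ! i"] by (simp add: w_def inner_commute)
    moreover have "norm (bs ! i) = 1"
      using bs(2) i len by (auto simp: orthonormal_def norm_eq_1)
    ultimately show "w i \<le> 1" by simp
  next
    have "(\<Sum>i<CARD('n). w i) = (\<Sum>q\<in>Q. \<Sum>i<CARD('n). (q \<bullet> bs ! i)\<^sup>2)"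
      unfolding w_def by (rule sum.swap)
    also have "\<dots> \<le> (\<Sum>q\<in>Q. 1)"
    proof (rule sum_mono)
      fix q assume "q \<in> Q"
      then have "norm q = 1" using Q(1) by (auto simp: orthonormal_def norm_eq_1)
      then show "(\<Sum>i<CARD('n). (q \<bullet> bs ! i)\<^sup>2) \<le> 1"
        using bessel_inequality[OF bs(2), of q] by (simp add: reindex)
    qed
    also have "\<dots> \<le> real r" using Q(2) by simp
    finally show "(\<Sum>i<CARD('n). w i) \<le> real r" .
  qed (use r dec nonneg in \<open>auto simp: \<mu>_def w_def sum_nonneg power_mono\<close>)
  also have "\<dots> = (r_norm r X)\<^sup>2" by (simp add: r_norm_sq \<mu>_def)
  finally show ?thesis .
qed

text \<open>
  Only the part of \<open>X\<close> in the column space of \<open>Y\<close> contributes to \<open>\<langle>X, Y\<rangle>\<close>, and Ky Fan's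
  inequality bounds the norm of that part by \<open>\<parallel>X\<parallel>\<^sub>r\<close>.
\<close>
lemma inner_le_r_norm:
  fixes X Y :: "real ^ 'm ^ 'n"
  assumes "rank Y \<le> r" and r: "r \<in> {1..CARD('n)}"
  shows "X \<bullet> Y \<le> r_norm r X * norm Y"
proof -
  have "subspace (range ((*v) Y))"
    by (intro linear_subspace_image subspace_UNIV matrix_vector_mul_linear)
  then obtain Q where Q: "orthonormal Q" "span Q = range ((*v) Y)" "card Q = dim (range ((*v) Y))"
    by (rule orthonormal_basis_of_subspace)
  have card: "card Q \<le> r" using assms(1) Q(3) by (simp add: rank_dim_range)
  have Y: "(\<Sum>q\<in>Q. (norm (q v* Y))\<^sup>2) = (norm Y)\<^sup>2"
    using inner_matrix_eq_sum_rows[OF Q(1), of Y Y] Q(2) by (simp add: power2_norm_eq_inner)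
  have "X \<bullet> Y = (\<Sum>q\<in>Q. (q v* X) \<bullet> (q v* Y))"
    by (rule inner_matrix_eq_sum_rows) (use Q in auto)
  also have "\<dots> \<le> (\<Sum>q\<in>Q. \<bar>norm (q v* X)\<bar> * \<bar>norm (q v* Y)\<bar>)"
    by (intro sum_mono) (simp add: norm_cauchy_schwarz)
  also have "\<dots> \<le> L2_set (\<lambda>q. norm (q v* X)) Q * L2_set (\<lambda>q. norm (q v* Y)) Q"
    by (rule L2_set_mult_ineq)
  also have "\<dots> \<le> r_norm r X * norm Y"
    unfolding L2_set_def Y
    using real_sqrt_le_mono[OF sum_norm_rows_le_r_norm[OF Q(1) card r, of X]] r_norm_nonneg[of r X]
    by (simp add: mult_right_mono)
  finally show ?thesis .
qed

lemma rank_scaleR_le: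
  fixes Y :: "real ^ 'm ^ 'n"
  shows "rank (c *\<^sub>R Y) \<le> rank Y"
proof -
  have "(c *\<^sub>R Y) *v x = Y *v (c *\<^sub>R x)" for x
    by (simp add: scaleR_matrix_vector_assoc[symmetric] matrix_vector_mult_scaleR)
  then have "range ((*v) (c *\<^sub>R Y)) \<subseteq> range ((*v) Y)" by auto
  then show ?thesis unfolding rank_dim_range by (rule dim_subset)
qed

text \<open>
  The maximizer is the normalized truncation of \<open>X\<close> to its \<open>r\<close> leading left singular vectors.
\<close>
lemma r_norm_attained:
  fixes X :: "real ^ 'm ^ 'n"
  assumes r: "r \<in> {1..CARD('n)}"
  obtains Y :: "real ^ 'm ^ 'n" where "rank Y \<le> r" "norm Y \<le> 1" "X \<bullet> Y = r_norm r X"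
proof -
  obtain bs where bs: "distinct bs" "orthonormal (set bs)" "span (set bs) = UNIV"
    and len: "length bs = CARD('n)"
    and eig: "\<And>i. i < CARD('n) \<Longrightarrow>
       (X ** transpose X) *v (bs ! i) = (singular_value (Suc i) X)\<^sup>2 *\<^sub>R (bs ! i)"
    by (rule left_singular_basis_exists[of X]) blast
  define T where "T = set (take r bs)"
  have T: "orthonormal T"
    using bs(2) set_take_subset[of r bs] unfolding T_def orthonormal_def by blast
  have cardT: "card T = r" using bs(1) len r by (simp add: T_def distinct_card)
  \<comment> \<open>\<open>P = \<Sum>\<^sub>b b (b\<^sup>T X)\<close> is the projection of \<open>X\<close> onto the span of the leading vectors\<close>
  define P :: "real ^ 'm ^ 'n" where "P = (\<chi> i j. \<Sum>b\<in>T. b $ i * (b v* X) $ j)"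
  have mulP: "P *v x = (\<Sum>b\<in>T. ((b v* X) \<bullet> x) *\<^sub>R b)" for x
    by (simp add: vec_eq_iff P_def matrix_vector_mult_def inner_vec_def sum_distrib_right
        sum_distrib_left sum.swap[of _ T] mult_ac)
  have ranP: "range ((*v) P) \<subseteq> span T"
    unfolding mulP by (blast intro: span_sum span_scale span_base)
  have rowP: "b v* P = b v* X" if b: "b \<in> T" for b
  proof -
    have "(b v* P) $ j = (b v* X) $ j" for j
    proof -
      have "(b v* P) $ j = (\<Sum>a\<in>T. (a v* X) $ j * (a \<bullet> b))"
      proof -
        have "(b v* P) $ j = (\<Sum>i\<in>UNIV. P $ i $ j * b $ i)"
          by (simp add: vector_matrix_mult_def mult.commute)
        also have "\<dots> = (\<Sum>i\<in>UNIV. \<Sum>a\<in>T. (a v* X) $ j * (a $ i * b $ i))"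
          by (simp add: P_def sum_distrib_left sum_distrib_right mult_ac)
        also have "\<dots> = (\<Sum>a\<in>T. \<Sum>i\<in>UNIV. (a v* X) $ j * (a $ i * b $ i))"
          by (rule sum.swap)
        finally show ?thesis unfolding inner_vec_def by (simp only: sum_distrib_left inner_real_def)
      qed
      also have "\<dots> = (\<Sum>a\<in>T. if a = b then (b v* X) $ j else 0)"
      proof (rule sum.cong)
        fix a assume "a \<in> T"
        then have "a \<bullet> b = (if a = b then 1 else 0)"
          using T b unfolding orthonormal_def by blast
        then show "(a v* X) $ j * (a \<bullet> b) = (if a = b then (b v* X) $ j else 0)" by simp
      qed simp
      also have "\<dots> = (b v* X) $ j" using b orthonormal_finite[OF T] by simp
      finally show ?thesis .
    qed
    then show ?thesis by (simp add: vec_eq_iff)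
  qed
  have rankP: "rank P \<le> r"
    using dim_subset[OF ranP] dim_le_card[OF subset_refl orthonormal_finite[OF T]] cardT
    by (simp add: rank_dim_range)
  have rows: "(\<Sum>b\<in>T. (norm (b v* X))\<^sup>2) = (r_norm r X)\<^sup>2"
  proof -
    have "(\<Sum>b\<in>T. (norm (b v* X))\<^sup>2) = (\<Sum>i<r. (norm (bs ! i v* X))\<^sup>2)"
      using bs(1) len r
      by (simp add: T_def sum.distinct_set_conv_list sum_list_sum_nth atLeast0LessThan)
    also have "\<dots> = (\<Sum>i<r. (singular_value (Suc i) X)\<^sup>2)"
    proof (rule sum.cong)
      fix i assume "i \<in> {..<r}"
      then have i: "i < CARD('n)" using r by simp
      have "bs ! i \<bullet> bs ! i = 1" using bs(2) i len by (auto simp: orthonormal_def)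
      then show "(norm (bs ! i v* X))\<^sup>2 = (singular_value (Suc i) X)\<^sup>2"
        by (simp only: power2_norm_eq_inner inner_gram[symmetric] eig[OF i] inner_scaleR_right mult_1_right)
    qed simp
    also have "\<dots> = (r_norm r X)\<^sup>2" by (rule r_norm_sq[symmetric])
    finally show ?thesis .
  qed
  have XP: "X \<bullet> P = (r_norm r X)\<^sup>2"
    using inner_matrix_eq_sum_rows[OF T ranP, of X] rows by (simp add: rowP power2_norm_eq_inner)
  have "(norm P)\<^sup>2 = (r_norm r X)\<^sup>2"
    using inner_matrix_eq_sum_rows[OF T ranP, of P] rows by (simp add: rowP power2_norm_eq_inner)
  then have PP: "norm P = r_norm r X"
    using r_norm_nonneg[of r X] by (simp add: power2_eq_iff_nonneg)
  show thesis
  proof (rule that)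
    let ?Y = "(1 / r_norm r X) *\<^sub>R P"
    \<comment> \<open>if the norm is \<open>0\<close>, division by zero makes \<open>?Y = 0\<close>, which is the right choice\<close>
    show "X \<bullet> ?Y = r_norm r X" by (simp add: XP power2_eq_square)
    show "norm ?Y \<le> 1" using PP by (cases "r_norm r X = 0") auto
    show "rank ?Y \<le> r" using rank_scaleR_le rankP by (rule order_trans)
  qed
qed

section \<open>Minimizers and separation for closed proper convex functions\<close>

text \<open>
  Separate the closed convex epigraph from the point one unit below a finite value of \<open>g\<close>.
  As the epigraph contains a point straight above it, the hyperplane is not vertical.
\<close>
lemma closed_proper_convex_affine_minorant:
  fixes g :: "'a::euclidean_space \<Rightarrow> ereal"
  assumes g: "closed_proper_convex g" and ninf: "\<And>x. g x \<noteq> -\<infinity>"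
  obtains a c where "\<And>x. ereal (a \<bullet> x + c) \<le> g x"
proof -
  obtain x0 t0 where "g x0 \<le> ereal t0"
    using g by (auto simp: closed_proper_convex_def ereal_epigraph_def)
  then obtain \<gamma> where \<gamma>: "g x0 = ereal \<gamma>"
    using ninf[of x0] by (cases "g x0") auto
  have "(x0, \<gamma> - 1) \<notin> ereal_epigraph g"
    by (simp add: ereal_epigraph_def \<gamma>)
  then obtain p \<beta> where p: "p \<bullet> (x0, \<gamma> - 1) < \<beta>" "\<forall>z\<in>ereal_epigraph g. \<beta> < p \<bullet> z"
    using g separating_hyperplane_closed_point[of "ereal_epigraph g" "(x0, \<gamma> - 1)"]
    by (auto simp: closed_proper_convex_def)
  obtain a b where ab: "p = (a, b)" by (cases p)
  have lower: "\<beta> < a \<bullet> x + b * t" if "g x \<le> ereal t" for x t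
    using p(2) that by (force simp: ab ereal_epigraph_def inner_prod_def)
  have b: "0 < b"
    using p(1) lower[of x0 \<gamma>] by (simp add: ab inner_prod_def \<gamma> algebra_simps)
  show thesis
  proof (rule that)
    fix x
    show "ereal ((- (1 / b) *\<^sub>R a) \<bullet> x + \<beta> / b) \<le> g x"
    proof (cases "g x")
      case (real t)
      then have "\<beta> - a \<bullet> x < b * t" using lower[of x t] by simp
      then have "(\<beta> - a \<bullet> x) / b \<le> t" using b by (simp add: pos_divide_le_eq mult.commute)
      then show ?thesis by (simp add: real diff_divide_distrib)
    qed (use ninf in auto)
  qed
qed

text \<open>
  The affine minorant of \<open>g\<close> cannot offset the quadratic growth of \<open>q\<close>, so the part of the
  epigraph of \<open>g\<close> over \<open>S\<close> on which \<open>q y + t\<close> does not exceed its value at \<open>p\<close> is compact.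
  Minimizing the continuous function \<open>q y + t\<close> there, rather than \<open>q + g\<close> on \<open>S\<close>, uses
  closedness of the epigraph in place of lower semicontinuity.
\<close>
lemma coercive_minimizer_exists:
  fixes g :: "'a::euclidean_space \<Rightarrow> ereal" and q :: "'a \<Rightarrow> real"
  assumes g: "closed_proper_convex g" and ninf: "\<And>x. g x \<noteq> -\<infinity>"
    and q: "continuous_on UNIV q" "\<And>x. (norm x)\<^sup>2 / 2 - B * norm x \<le> q x"
    and B: "0 \<le> B" and S: "closed S" "p \<in> S" "g p < \<infinity>"
  obtains x where "x \<in> S" "g x < \<infinity>"
    "\<And>y. y \<in> S \<Longrightarrow> ereal (q x) + g x \<le> ereal (q y) + g y"
proof -
  obtain a c where minor: "\<And>x. ereal (a \<bullet> x + c) \<le> g x"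
    using closed_proper_convex_affine_minorant[OF g ninf] by blast
  obtain \<gamma> where \<gamma>: "g p = ereal \<gamma>" using ninf[of p] S(3) by (cases "g p") auto
  define v where "v = q p + \<gamma>"
  define E where "E = ereal_epigraph g \<inter> S \<times> UNIV \<inter> {z. q (fst z) + snd z \<le> v}"
  define K where "K = B + norm a"
  define W where "W = \<bar>v - c\<bar>"
  have W: "0 \<le> W" "v - c \<le> W" by (simp_all add: W_def)
  \<comment> \<open>beyond the radius \<open>R\<close> half the square of the norm exceeds \<open>K\<close> times the norm plus \<open>W\<close>\<close>
  define R where "R = 2 * K + 2 * W + 1"
  have E: "norm y \<le> R \<and> - norm a * R + c \<le> t \<and> t \<le> v + B * R" if "(y, t) \<in> E" for y t
  proof -
    have t: "q y + t \<le> v" "g y \<le> ereal t" using that by (auto simp: E_def ereal_epigraph_def)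
    have "ereal (a \<bullet> y + c) \<le> ereal t" using minor[of y] t(2) by (rule order_trans)
    moreover have "- (norm a * norm y) \<le> a \<bullet> y"
      using Cauchy_Schwarz_ineq2[of a y] by linarith
    ultimately have lo: "- (norm a * norm y) + c \<le> t" by simp
    have quad: "(norm y)\<^sup>2 / 2 \<le> K * norm y + W"
    proof -
      have "K * norm y = B * norm y + norm a * norm y" by (simp add: K_def algebra_simps)
      then show ?thesis using q(2)[of y] t(1) lo W by linarith
    qed
    have K: "0 \<le> K" using B by (simp add: K_def)
    have R: "norm y \<le> R"
    proof (rule ccontr)
      assume "\<not> norm y \<le> R"
      then have big: "R < norm y" by simp
      then have one: "1 < norm y" using K W by (simp add: R_def)
      have "(K + W) * norm y < (norm y / 2) * norm y"
        using big one by (intro mult_strict_right_mono) (auto simp: R_def)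
      moreover have "W * 1 \<le> W * norm y" using one W(1) by (intro mult_left_mono) auto
      ultimately show False using quad by (simp add: power2_eq_square algebra_simps)
    qed
    have "norm a * norm y \<le> norm a * R" "B * norm y \<le> B * R"
      using R B by (auto intro: mult_left_mono)
    moreover have "0 \<le> (norm y)\<^sup>2 / 2" by simp
    ultimately have "- norm a * R + c \<le> t" "t \<le> v + B * R"
      using lo t(1) q(2)[of y] by linarith+
    then show ?thesis using R by blast
  qed
  have "E \<subseteq> cball 0 R \<times> {- norm a * R + c .. v + B * R}" using E by auto
  then have "bounded E" by (rule bounded_subset[rotated]) (intro bounded_Times bounded_cball bounded_closed_interval)
  moreover have "closed {z. q (fst z) + snd z \<le> v}"
    by (intro closed_Collect_le continuous_intros continuous_on_compose2[OF q(1)]) auto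
  then have "closed E"
    using g S(1) unfolding E_def closed_proper_convex_def
    by (intro closed_Int closed_Times) auto
  ultimately have "compact E" by (simp add: compact_eq_bounded_closed)
  moreover have "(p, \<gamma>) \<in> E" using S by (simp add: E_def ereal_epigraph_def \<gamma> v_def)
  moreover have "continuous_on E (\<lambda>z. q (fst z) + snd z)"
    by (intro continuous_intros continuous_on_compose2[OF q(1)]) auto
  ultimately obtain z where z: "z \<in> E"
      and least: "\<And>w. w \<in> E \<Longrightarrow> q (fst z) + snd z \<le> q (fst w) + snd w"
    using continuous_attains_inf[of E "\<lambda>z. q (fst z) + snd z"] by blast
  obtain x t where xt: "z = (x, t)" by (cases z)
  have x: "x \<in> S" "g x \<le> ereal t" "q x + t \<le> v"
    using z by (auto simp: xt E_def ereal_epigraph_def)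
  show thesis
  proof (rule that)
    show "g x < \<infinity>" using x(2) by auto
    fix y assume y: "y \<in> S"
    have "ereal (q x) + g x \<le> ereal (q x + t)"
      using add_left_mono[OF x(2), of "ereal (q x)"] by simp
    also have "\<dots> \<le> ereal (q y) + g y"
    proof (cases "g y")
      case (real s)
      have "q x + t \<le> q y + s"
      proof (cases "q y + s \<le> v")
        case True
        then have "(y, s) \<in> E" using y real by (simp add: E_def ereal_epigraph_def)
        from least[OF this] show ?thesis by (simp add: xt)
      next
        case False
        then show ?thesis using x(3) by simp
      qed
      then show ?thesis by (simp add: real)
    qed (use ninf in auto)
    finally show "ereal (q x) + g x \<le> ereal (q y) + g y" .
  qed (fact x(1))
qed

text \<open>
  The conclusion says that the concave function \<open>v - f\<close> and the convex function \<open>g\<close>, both tilted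
  by \<open>d\<close>, are separated by a constant.  Taking the infimum over \<open>x\<close> and the supremum over \<open>y\<close> gives
  \<open>v \<le> - f\<^sup>*(d) - g\<^sup>*(- d)\<close>, the nontrivial half of Fenchel duality
  together with attainment of the dual optimum.
\<close>
lemma fenchel_separation:
  fixes g :: "'a::euclidean_space \<Rightarrow> ereal" and f :: "'a \<Rightarrow> real"
  assumes f: "convex_on UNIV f" and g: "closed_proper_convex g"
    and v: "\<And>x. ereal v \<le> ereal (f x) + g x"
  obtains d where "\<And>x y t. g x \<le> ereal t \<Longrightarrow> v - f y + d \<bullet> y \<le> t + d \<bullet> x"
proof -
  define H where "H = {(y, t). f y + t < v}"
  have "convex H"
  proof (rule convexI)
    fix z z' u w assume *: "z \<in> H" "z' \<in> H" "0 \<le> u" "0 \<le> w" "u + w = (1::real)"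
    obtain y t y' t' where [simp]: "z = (y, t)" "z' = (y', t')" by (cases z, cases z')
    have "f (u *\<^sub>R y + w *\<^sub>R y') \<le> u * f y + w * f y'"
      using f * by (auto simp: convex_on_def)
    moreover have "u * (f y + t) + w * (f y' + t') < v"
      using * by (intro convex_bound_lt) (auto simp: H_def)
    ultimately show "u *\<^sub>R z + w *\<^sub>R z' \<in> H" by (simp add: H_def algebra_simps)
  qed
  moreover have "(0, v - f 0 - 1) \<in> H" by (simp add: H_def)
  moreover have "H \<inter> ereal_epigraph g = {}"
  proof (rule ccontr)
    assume "H \<inter> ereal_epigraph g \<noteq> {}"
    then obtain x t where xt: "f x + t < v" "g x \<le> ereal t"
      by (auto simp: H_def ereal_epigraph_def)
    have "ereal v \<le> ereal (f x) + ereal t"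
      using v[of x] add_left_mono[OF xt(2), of "ereal (f x)"] by (rule order_trans)
    then show False using xt(1) by simp
  qed
  ultimately have "\<exists>n b. n \<noteq> 0 \<and> (\<forall>z\<in>H. n \<bullet> z \<le> b) \<and> (\<forall>z\<in>ereal_epigraph g. n \<bullet> z \<ge> b)"
    using g by (intro separating_hyperplane_sets) (auto simp: closed_proper_convex_def)
  then obtain n b where n: "n \<noteq> 0" and below: "\<forall>z\<in>H. n \<bullet> z \<le> b"
      and above: "\<forall>z\<in>ereal_epigraph g. b \<le> n \<bullet> z"
    by blast
  obtain p \<beta> where p: "n = (p, \<beta>)" by (cases n)
  have below: "p \<bullet> y + \<beta> * t \<le> b" if "f y + t < v" for y t
    using below that by (force simp: H_def p inner_prod_def)
  have above: "b \<le> p \<bullet> x + \<beta> * t" if "g x \<le> ereal t" for x t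
    using above that by (force simp: ereal_epigraph_def p inner_prod_def)
  \<comment> \<open>the hypograph extends downwards without bound\<close>
  have "\<not> \<beta> < 0"
  proof
    assume neg: "\<beta> < 0"
    define t where "t = min (v - f 0 - 1) ((b + 1) / \<beta>)"
    have "\<beta> * t \<le> b" using below[of 0 t] by (simp add: t_def)
    moreover have "\<beta> * ((b + 1) / \<beta>) \<le> \<beta> * t"
      using neg by (intro mult_left_mono_neg) (auto simp: t_def)
    ultimately show False using neg by simp
  qed
  \<comment> \<open>the hypograph projects onto the whole space, so no vertical hyperplane bounds it\<close>
  moreover have "\<beta> \<noteq> 0"
  proof
    assume zero: "\<beta> = 0"
    then have "p \<bullet> p \<noteq> 0" using n by (simp add: p zero_prod_def)
    moreover have "p \<bullet> (((b + 1) / (p \<bullet> p)) *\<^sub>R p) \<le> b"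
      using below[of "((b + 1) / (p \<bullet> p)) *\<^sub>R p" "v - f (((b + 1) / (p \<bullet> p)) *\<^sub>R p) - 1"] zero
      by simp
    ultimately show False by simp
  qed
  ultimately have pos: "0 < \<beta>" by simp
  show thesis
  proof (rule that)
    fix x y t assume t: "g x \<le> ereal t"
    \<comment> \<open>pass from the strict hypograph to its boundary\<close>
    have "p \<bullet> y + \<beta> * (v - f y) \<le> b"
    proof (rule field_le_epsilon)
      fix e :: real assume "0 < e"
      then show "p \<bullet> y + \<beta> * (v - f y) \<le> b + e"
        using below[of y "v - f y - e / \<beta>"] pos by (simp add: algebra_simps)
    qed
    then have "p \<bullet> y + \<beta> * (v - f y) \<le> p \<bullet> x + \<beta> * t"
      using above[OF t] by (rule order_trans)
    then have "(p \<bullet> y + \<beta> * (v - f y)) / \<beta> \<le> (p \<bullet> x + \<beta> * t) / \<beta>"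
      using pos by (simp add: divide_right_mono)
    then show "v - f y + ((1 / \<beta>) *\<^sub>R p) \<bullet> y \<le> t + ((1 / \<beta>) *\<^sub>R p) \<bullet> x"
      using pos by (simp add: add_divide_distrib)
  qed
qed

section \<open>The dual of the r-norm\<close>

lemma rank_Basis_le_1:
  fixes E :: "real ^ 'm ^ 'n"
  assumes "E \<in> Basis"
  shows "rank E \<le> 1"
proof -
  obtain i j where E: "E = axis i (axis j 1)"
    using assms by (auto simp: Basis_vec_def)
  have "E *v x = x $ j *\<^sub>R axis i 1" for x
  proof -
    have "(E *v x) $ k = (x $ j *\<^sub>R axis i 1) $ k" for k
    proof -
      have "(E *v x) $ k = (\<Sum>l\<in>UNIV. if l = j then (if k = i then x $ j else 0) else 0)"
        unfolding matrix_vector_mult_def E vec_lambda_beta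
        by (intro sum.cong) (auto simp: axis_def)
      then show ?thesis by (simp add: axis_def)
    qed
    then show ?thesis by (simp add: vec_eq_iff)
  qed
  then have "range ((*v) E) \<subseteq> span {axis i 1}"
    by (auto intro: span_scale span_base)
  then have "dim (range ((*v) E)) \<le> dim {axis i (1::real)}"
    by (metis dim_span dim_subset)
  also have "\<dots> \<le> card {axis i (1::real) :: real ^ 'n}" by (intro dim_le_card') simp
  finally show ?thesis by (simp add: rank_dim_range)
qed

context
  fixes r :: nat
  assumes r: "r \<in> {1..CARD('n::finite)}"
begin

lemma r_norm_upper:
  fixes X Y :: "real ^ 'm ^ 'n"
  assumes "rank Y \<le> r" "norm Y \<le> 1"
  shows "X \<bullet> Y \<le> r_norm r X"
proof -
  have "X \<bullet> Y \<le> r_norm r X * norm Y" by (rule inner_le_r_norm[OF assms(1) r])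
  also have "\<dots> \<le> r_norm r X * 1" using assms(2) by (intro mult_left_mono r_norm_nonneg)
  finally show ?thesis by simp
qed

lemma r_norm_le_norm:
  fixes X :: "real ^ 'm ^ 'n"
  shows "r_norm r X \<le> norm X"
proof -
  obtain Y :: "real ^ 'm ^ 'n" where Y: "norm Y \<le> 1" "X \<bullet> Y = r_norm r X"
    using r_norm_attained[OF r] by metis
  have "X \<bullet> Y \<le> norm X * norm Y" by (rule norm_cauchy_schwarz)
  also have "\<dots> \<le> norm X * 1" using Y by (intro mult_left_mono) auto
  finally show ?thesis using Y by simp
qed

lemma r_norm_scaleR_le:
  fixes X :: "real ^ 'm ^ 'n"
  assumes "0 \<le> c"
  shows "r_norm r (c *\<^sub>R X) \<le> c * r_norm r X"
proof -
  obtain Y :: "real ^ 'm ^ 'n" where Y: "rank Y \<le> r" "norm Y \<le> 1" "c *\<^sub>R X \<bullet> Y = r_norm r (c *\<^sub>R X)"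
    by (rule r_norm_attained[OF r])
  have "c * (X \<bullet> Y) \<le> c * r_norm r X"
    using assms Y by (intro mult_left_mono r_norm_upper)
  then show ?thesis using Y(3) by simp
qed

text \<open>
  Matrix units have rank one, so the support formula bounds each entry.  In
  particular the unit ball of the \<open>r\<close>-norm is bounded, and the dual norm is finite.
\<close>
lemma norm_le_r_norm:
  fixes X :: "real ^ 'm ^ 'n"
  shows "norm X \<le> real DIM(real ^ 'm ^ 'n) * r_norm r X"
proof -
  have "\<bar>X \<bullet> E\<bar> \<le> r_norm r X" if E: "E \<in> Basis" for E
  proof -
    have rank: "rank E \<le> r" using rank_Basis_le_1[OF E] r by simp
    have "rank (- E) \<le> r" using order_trans[OF rank_scaleR_le[of "-1" E] rank] by simp
    then have "X \<bullet> (- E) \<le> r_norm r X" using E by (intro r_norm_upper) auto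
    moreover have "X \<bullet> E \<le> r_norm r X" using E rank by (intro r_norm_upper) auto
    ultimately show ?thesis by simp
  qed
  then have "(\<Sum>E\<in>Basis. \<bar>X \<bullet> E\<bar>) \<le> real DIM(real ^ 'm ^ 'n) * r_norm r X"
    by (rule sum_bounded_above)
  with norm_le_l1[of X] show ?thesis by (rule order_trans)
qed

lemma continuous_on_r_norm: "continuous_on UNIV (r_norm r :: real ^ 'm ^ 'n \<Rightarrow> real)"
proof (rule convex_on_continuous[OF open_UNIV], rule convex_onI)
  fix t :: real and X Z :: "real ^ 'm ^ 'n"
  assume t: "0 < t" "t < 1"
  obtain Y :: "real ^ 'm ^ 'n" where Y: "rank Y \<le> r" "norm Y \<le> 1"
      "((1 - t) *\<^sub>R X + t *\<^sub>R Z) \<bullet> Y = r_norm r ((1 - t) *\<^sub>R X + t *\<^sub>R Z)"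
    by (rule r_norm_attained[OF r])
  have "(1 - t) * (X \<bullet> Y) + t * (Z \<bullet> Y) \<le> (1 - t) * r_norm r X + t * r_norm r Z"
    using t Y by (intro add_mono mult_left_mono r_norm_upper) auto
  then show "r_norm r ((1 - t) *\<^sub>R X + t *\<^sub>R Z) \<le> (1 - t) * r_norm r X + t * r_norm r Z"
    using Y(3) by (simp add: inner_add_left)
qed simp

text \<open>
  If \<open>Y\<close> in the rank-\<open>r\<close> unit ball attains \<open>\<parallel>M\<parallel>\<^sub>r\<close> and this is at least the Frobenius norm
  of \<open>M\<close>, then Cauchy-Schwarz is an equality for \<open>M\<close> and \<open>Y\<close>, hence \<open>M\<close> is a multiple of \<open>Y\<close>.  The
  equivalence expresses the rank constraint by an inequality between continuous functions.
\<close>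
lemma rank_le_iff_norm_le_r_norm:
  fixes M :: "real ^ 'm ^ 'n"
  shows "rank M \<le> r \<longleftrightarrow> norm M \<le> r_norm r M"
proof
  assume "rank M \<le> r"
  from inner_le_r_norm[OF this r, of M] have "norm M * norm M \<le> r_norm r M * norm M"
    by (simp add: power2_norm_eq_inner[symmetric] power2_eq_square)
  then show "norm M \<le> r_norm r M"
    using r_norm_nonneg[of r M] by (cases "norm M = 0") auto
next
  assume le: "norm M \<le> r_norm r M"
  obtain Y :: "real ^ 'm ^ 'n" where Y: "rank Y \<le> r" "norm Y \<le> 1" "M \<bullet> Y = r_norm r M"
    by (rule r_norm_attained[OF r])
  have "(norm (M - c *\<^sub>R Y))\<^sup>2 = (norm M)\<^sup>2 - 2 * c * (M \<bullet> Y) + c\<^sup>2 * (norm Y)\<^sup>2" for c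
    unfolding power2_norm_eq_inner
    by (simp add: inner_diff_left inner_diff_right inner_commute[of Y M] power2_eq_square[of c] algebra_simps)
  then have "(norm (M - norm M *\<^sub>R Y))\<^sup>2
      = (norm M)\<^sup>2 - 2 * norm M * (M \<bullet> Y) + (norm M)\<^sup>2 * (norm Y)\<^sup>2" .
  also have "\<dots> \<le> (norm M)\<^sup>2 - 2 * norm M * norm M + (norm M)\<^sup>2 * 1"
    using le Y by (intro add_mono diff_mono mult_left_mono) (auto simp: power_le_one)
  also have "\<dots> = 0" by (simp add: power2_eq_square)
  finally have "M = norm M *\<^sub>R Y" by simp
  then show "rank M \<le> r"
    using rank_scaleR_le[of "norm M" Y] Y(1) by simp
qed

lemma closed_rank_le: "closed {M :: real ^ 'm ^ 'n. rank M \<le> r}"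
  unfolding rank_le_iff_norm_le_r_norm
  by (intro closed_Collect_le continuous_on_norm continuous_on_id continuous_on_r_norm)

lemma r_dual_norm_upper:
  fixes M X :: "real ^ 'm ^ 'n"
  assumes "r_norm r X \<le> 1"
  shows "M \<bullet> X \<le> r_dual_norm r M"
  unfolding r_dual_norm_def
proof (rule cSUP_upper)
  show "bdd_above ((\<bullet>) M ` {X. r_norm r X \<le> 1})"
  proof (rule bdd_aboveI2)
    fix X :: "real ^ 'm ^ 'n" assume X: "X \<in> {X. r_norm r X \<le> 1}"
    have "M \<bullet> X \<le> norm M * norm X" by (rule norm_cauchy_schwarz)
    also have "norm X \<le> real DIM(real ^ 'm ^ 'n) * r_norm r X" by (rule norm_le_r_norm)
    also have "\<dots> \<le> real DIM(real ^ 'm ^ 'n) * 1" using X by (intro mult_left_mono) auto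
    finally show "M \<bullet> X \<le> norm M * (real DIM(real ^ 'm ^ 'n) * 1)" by (simp add: mult_left_mono)
  qed
qed (use assms in simp)

lemma r_dual_norm_least:
  fixes M :: "real ^ 'm ^ 'n"
  assumes "\<And>X. r_norm r X \<le> 1 \<Longrightarrow> M \<bullet> X \<le> b"
  shows "r_dual_norm r M \<le> b"
  unfolding r_dual_norm_def
proof (rule cSUP_least)
  have "r_norm r (0 :: real ^ 'm ^ 'n) \<le> norm (0 :: real ^ 'm ^ 'n)" by (rule r_norm_le_norm)
  also have "\<dots> \<le> 1" by simp
  finally have "r_norm r (0 :: real ^ 'm ^ 'n) \<le> 1" .
  then show "{X :: real ^ 'm ^ 'n. r_norm r X \<le> 1} \<noteq> {}" by blast
qed (use assms in simp)

lemma inner_le_r_dual_norm: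
  fixes M X :: "real ^ 'm ^ 'n"
  shows "M \<bullet> X \<le> r_dual_norm r M * r_norm r X"
proof (cases "r_norm r X = 0")
  case True
  then have "X = 0" using norm_le_r_norm[of X] by simp
  then show ?thesis using True by simp
next
  case False
  then have pos: "0 < r_norm r X" using r_norm_nonneg[of r X] by simp
  have "r_norm r ((1 / r_norm r X) *\<^sub>R X) \<le> 1"
    using r_norm_scaleR_le[of "1 / r_norm r X" X] pos by simp
  from r_dual_norm_upper[OF this, of M] show ?thesis
    using pos by (simp add: divide_simps)
qed

lemma norm_le_r_dual_norm:
  fixes M :: "real ^ 'm ^ 'n"
  shows "norm M \<le> r_dual_norm r M"
proof -
  have "r_norm r ((1 / norm M) *\<^sub>R M) \<le> norm ((1 / norm M) *\<^sub>R M)" by (rule r_norm_le_norm)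
  also have "\<dots> \<le> 1" by (cases "M = 0") auto
  finally have "M \<bullet> ((1 / norm M) *\<^sub>R M) \<le> r_dual_norm r M" by (rule r_dual_norm_upper)
  then show ?thesis by (cases "M = 0") (simp_all add: power2_norm_eq_inner[symmetric] power2_eq_square)
qed

lemma r_dual_norm_eq_norm:
  fixes M :: "real ^ 'm ^ 'n"
  assumes "rank M \<le> r"
  shows "r_dual_norm r M = norm M"
proof (rule antisym)
  show "r_dual_norm r M \<le> norm M"
  proof (rule r_dual_norm_least)
    fix X :: "real ^ 'm ^ 'n" assume "r_norm r X \<le> 1"
    then have "r_norm r X * norm M \<le> 1 * norm M" by (intro mult_right_mono) auto
    with inner_le_r_norm[OF assms r, of X] show "M \<bullet> X \<le> norm M" by (simp add: inner_commute)
  qed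
qed (rule norm_le_r_dual_norm)

text \<open>The dual norm is convex as a supremum of linear forms, and nonnegative, so squaring keeps convexity.\<close>
lemma convex_on_r_dual_norm_sq:
  "convex_on UNIV (\<lambda>M :: real ^ 'm ^ 'n. (r_dual_norm r M)\<^sup>2)"
proof (rule convex_onI)
  fix t :: real and M M' :: "real ^ 'm ^ 'n"
  assume t: "0 < t" "t < 1"
  let ?a = "r_dual_norm r M" and ?b = "r_dual_norm r M'"
  let ?c = "r_dual_norm r ((1 - t) *\<^sub>R M + t *\<^sub>R M')"
  have "?c \<le> (1 - t) * ?a + t * ?b"
  proof (rule r_dual_norm_least)
    fix X :: "real ^ 'm ^ 'n" assume X: "r_norm r X \<le> 1"
    have "(1 - t) * (M \<bullet> X) + t * (M' \<bullet> X) \<le> (1 - t) * ?a + t * ?b"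
      using t X by (intro add_mono mult_left_mono r_dual_norm_upper) auto
    then show "((1 - t) *\<^sub>R M + t *\<^sub>R M') \<bullet> X \<le> (1 - t) * ?a + t * ?b"
      by (simp add: inner_add_left)
  qed
  moreover have "0 \<le> ?c" using norm_ge_zero norm_le_r_dual_norm by (rule order_trans)
  ultimately have "?c\<^sup>2 \<le> ((1 - t) * ?a + t * ?b)\<^sup>2" by (rule power_mono)
  also have "\<dots> = (1 - t) * ?a\<^sup>2 + t * ?b\<^sup>2 - t * (1 - t) * (?a - ?b)\<^sup>2"
    by (simp add: power2_eq_square algebra_simps)
  also have "\<dots> \<le> (1 - t) * ?a\<^sup>2 + t * ?b\<^sup>2" using t by simp
  finally show "?c\<^sup>2 \<le> (1 - t) * ?a\<^sup>2 + t * ?b\<^sup>2" .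
qed simp

end

section \<open>Duality for the relaxed problem\<close>

text \<open>The part of the relaxed objective that is finite everywhere.\<close>
definition relaxed_quadratic :: "nat \<Rightarrow> real ^ 'm ^ 'n \<Rightarrow> real ^ 'm ^ 'n \<Rightarrow> real" where
  "relaxed_quadratic r N M = 1/2 * (r_dual_norm r M)\<^sup>2 - N \<bullet> M + 1/2 * (norm N)\<^sup>2"

lemma convex_on_relaxed_quadratic:
  fixes N :: "real ^ 'm ^ 'n"
  assumes r: "r \<in> {1..CARD('n)}"
  shows "convex_on UNIV (relaxed_quadratic r N)"
proof -
  have sq: "convex_on UNIV (\<lambda>M :: real ^ 'm ^ 'n. 1/2 * (r_dual_norm r M)\<^sup>2)"
    by (intro convex_on_cmul convex_on_r_dual_norm_sq[OF r]) simp
  have lin: "convex_on UNIV (\<lambda>M. - (N \<bullet> M) + k)" for k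
    by (rule convex_onI) (auto simp: inner_add_right algebra_simps)
  from convex_on_add[OF sq lin[of "1/2 * (norm N)\<^sup>2"]] show ?thesis
    by (simp add: relaxed_quadratic_def[abs_def] algebra_simps)
qed

text \<open>The relaxation is exact on the feasible matrices of the rank-constrained problem.\<close>
lemma relaxed_quadratic_eq_of_rank_le:
  fixes N :: "real ^ 'm ^ 'n"
  assumes r: "r \<in> {1..CARD('n)}" and M: "rank M \<le> r"
  shows "relaxed_quadratic r N M = 1/2 * (norm (N - M))\<^sup>2"
  unfolding relaxed_quadratic_def r_dual_norm_eq_norm[OF r M]
  by (simp add: power2_norm_eq_inner inner_diff_left inner_diff_right inner_commute[of M N] field_simps)

text \<open>
  Bound the conjugate from below by its term at \<open>M\<close>, and apply
  \<open>\<langle>M, X\<rangle> \<le> \<parallel>M\<parallel>\<^sub>r\<^sub>* \<parallel>X\<parallel>\<^sub>r \<le> (\<parallel>M\<parallel>\<^sub>r\<^sub>*\<^sup>2 + \<parallel>X\<parallel>\<^sub>r\<^sup>2) / 2\<close> to \<open>X = N + D\<close>.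
\<close>
lemma weak_duality:
  fixes N D M :: "real ^ 'm ^ 'n"
  assumes r: "r \<in> {1..CARD('n)}"
  shows "- relaxed_objective r N g M \<le> dual_objective r N g D"
proof (cases "g M")
  case (real \<gamma>)
  let ?a = "r_dual_norm r M" and ?\<rho> = "r_norm r (N + D)"
  have "ereal ((- D) \<bullet> M - \<gamma>) \<le> conjugate g (- D)"
    unfolding conjugate_def by (rule SUP_upper2[of M]) (auto simp: real)
  then have "ereal ((- D) \<bullet> M - \<gamma>) + ereal (1/2 * ?\<rho>\<^sup>2 - 1/2 * (norm N)\<^sup>2)
      \<le> dual_objective r N g D"
    unfolding dual_objective_def by (rule add_right_mono)
  moreover have "- relaxed_objective r N g M
      \<le> ereal ((- D) \<bullet> M - \<gamma>) + ereal (1/2 * ?\<rho>\<^sup>2 - 1/2 * (norm N)\<^sup>2)"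
  proof -
    have "(N + D) \<bullet> M \<le> ?a * ?\<rho>"
      using inner_le_r_dual_norm[OF r, of M "N + D"] by (simp add: inner_commute)
    moreover have "0 \<le> (?a - ?\<rho>)\<^sup>2" by simp
    ultimately show ?thesis
      by (simp add: relaxed_objective_def real inner_add_left power2_diff)
  qed
  ultimately show ?thesis by (rule order_trans[rotated])
next
  case PInf
  then show ?thesis by (simp add: relaxed_objective_def)
next
  case MInf
  have "conjugate g (- D) = \<infinity>"
    unfolding conjugate_def by (rule antisym[OF ereal_less_eq(1)], rule SUP_upper2[of M]) (auto simp: MInf)
  then show ?thesis by (simp add: dual_objective_def)
qed

text \<open>
  The separating slope \<open>D\<close> bounds \<open>conjugate g (- D)\<close> by the value of
  \<open>relaxed_quadratic r N M' - D \<bullet> M'\<close> at any \<open>M'\<close>, up to the constant \<open>v\<close>.  The choice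
  \<open>M' = \<rho> Y\<close>, with \<open>Y\<close> attaining \<open>\<rho> = \<parallel>N + D\<parallel>\<^sub>r\<close>, minimizes that expression: apart from the
  constant \<open>(norm N)\<^sup>2 / 2\<close>, the quadratic part is at most \<open>\<rho>\<^sup>2 / 2\<close> and the linear part is \<open>- \<rho>\<^sup>2\<close>.
\<close>
lemma dual_value_attained:
  fixes N :: "real ^ 'm ^ 'n"
  assumes r: "r \<in> {1..CARD('n)}"
    and g: "closed_proper_convex g" and ninf: "\<And>M. g M \<noteq> -\<infinity>"
    and v: "\<And>M. ereal v \<le> relaxed_objective r N g M"
  obtains D where "dual_objective r N g D \<le> ereal (- v)"
proof -
  obtain D where D: "\<And>M M' t. g M \<le> ereal t \<Longrightarrow>
      v - relaxed_quadratic r N M' + D \<bullet> M' \<le> t + D \<bullet> M"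
    using fenchel_separation[OF convex_on_relaxed_quadratic[OF r, of N] g, of v] v
    by (auto simp: relaxed_objective_def relaxed_quadratic_def)
  define \<rho> where "\<rho> = r_norm r (N + D)"
  obtain Y :: "real ^ 'm ^ 'n" where Y: "rank Y \<le> r" "norm Y \<le> 1" "(N + D) \<bullet> Y = \<rho>"
    unfolding \<rho>_def by (rule r_norm_attained[OF r])
  have rho: "0 \<le> \<rho>" by (simp add: \<rho>_def r_norm_nonneg)
  define b where "b = 1/2 * (norm N)\<^sup>2 - 1/2 * \<rho>\<^sup>2 - v"
  have quad: "relaxed_quadratic r N (\<rho> *\<^sub>R Y) - D \<bullet> (\<rho> *\<^sub>R Y) \<le> 1/2 * (norm N)\<^sup>2 - 1/2 * \<rho>\<^sup>2"
  proof -
    have rank: "rank (\<rho> *\<^sub>R Y) \<le> r" using rank_scaleR_le Y(1) by (rule order_trans)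
    have "\<rho>\<^sup>2 * (norm Y)\<^sup>2 \<le> \<rho>\<^sup>2 * 1" using Y(2) by (intro mult_left_mono) (auto simp: power_le_one)
    moreover have "N \<bullet> (\<rho> *\<^sub>R Y) + D \<bullet> (\<rho> *\<^sub>R Y) = \<rho>\<^sup>2"
      using Y(3) by (simp add: inner_add_left power2_eq_square flip: distrib_left)
    ultimately show ?thesis
      unfolding relaxed_quadratic_def r_dual_norm_eq_norm[OF r rank]
      using rho by (simp add: power_mult_distrib)
  qed
  have "conjugate g (- D) \<le> ereal b"
    unfolding conjugate_def
  proof (rule SUP_least)
    fix M
    show "ereal ((- D) \<bullet> M) - g M \<le> ereal b"
    proof (cases "g M")
      case (real t)
      then show ?thesis using D[of M t "\<rho> *\<^sub>R Y"] quad by (simp add: b_def)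
    qed (use ninf in auto)
  qed
  then have "dual_objective r N g D \<le> ereal b + ereal (1/2 * \<rho>\<^sup>2 - 1/2 * (norm N)\<^sup>2)"
    unfolding dual_objective_def \<rho>_def by (rule add_right_mono)
  then show thesis using that by (simp add: b_def)
qed

section \<open>The rank-constrained problem and its relaxation\<close>

theorem proposition2:
  fixes N :: "real ^ 'm ^ 'n"
    and g :: "real ^ 'm ^ 'n \<Rightarrow> ereal"
    and r :: nat
  assumes "CARD('n) \<le> CARD('m)"
    and "\<forall>M. g M \<noteq> -\<infinity>"
    and "closed_proper_convex g"
    and "r \<in> {1..CARD('n)}"
    and "\<exists>M. rank M \<le> r \<and> g M < \<infinity>"
  shows "(\<exists>p d c. is_min_on (rank_objective N g) {M. rank M \<le> r} p \<and>
                  is_min_on (dual_objective r N g) UNIV d \<and>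
                  is_min_on (relaxed_objective r N g) UNIV c \<and>
                  p \<ge> - d \<and> - d = c) \<and>
         ((\<exists>M\<in>argmin_on (relaxed_objective r N g) UNIV. rank M \<le> r) \<longrightarrow>
            argmin_on (rank_objective N g) {M. rank M \<le> r}
              \<subseteq> argmin_on (relaxed_objective r N g) UNIV)"
proof -
  note r = assms(4) and g = assms(3)
  have ninf: "\<And>M. g M \<noteq> -\<infinity>" using assms(2) by blast
  obtain M0 where M0: "rank M0 \<le> r" "g M0 < \<infinity>" using assms(5) by blast
  have argmin: "x \<in> argmin_on f S \<longleftrightarrow> x \<in> S \<and> (\<forall>y\<in>S. f x \<le> f y)"
    for f :: "real ^ 'm ^ 'n \<Rightarrow> ereal" and S x
    by (auto simp: argmin_on_def is_arg_min_linorder)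
  have relaxed: "relaxed_objective r N g M = ereal (relaxed_quadratic r N M) + g M" for M
    by (simp add: relaxed_objective_def relaxed_quadratic_def)
  have agree: "relaxed_objective r N g M = rank_objective N g M" if "rank M \<le> r" for M
    unfolding relaxed rank_objective_def relaxed_quadratic_eq_of_rank_le[OF r that] ..
  obtain Mp where Mp: "rank Mp \<le> r" "\<And>M. rank M \<le> r \<Longrightarrow> rank_objective N g Mp \<le> rank_objective N g M"
  proof (rule coercive_minimizer_exists[OF g ninf _ _ norm_ge_zero[of N] closed_rank_le[OF r], where p = M0
        and q = "\<lambda>M. 1/2 * (norm (N - M))\<^sup>2"])
    show "continuous_on UNIV (\<lambda>M. 1/2 * (norm (N - M))\<^sup>2)" by (intro continuous_intros)
    fix M :: "real ^ 'm ^ 'n"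
    have "(norm (N - M))\<^sup>2 = (norm N)\<^sup>2 - 2 * (N \<bullet> M) + (norm M)\<^sup>2"
      by (simp add: power2_norm_eq_inner inner_diff_left inner_diff_right inner_commute[of M N])
    then show "(norm M)\<^sup>2 / 2 - norm N * norm M \<le> 1/2 * (norm (N - M))\<^sup>2"
      using norm_cauchy_schwarz[of N M] zero_le_power2[of "norm N"] by linarith
  qed (use M0 that in \<open>auto simp: rank_objective_def\<close>)
  obtain Mc where Mc: "g Mc < \<infinity>" "\<And>M. relaxed_objective r N g Mc \<le> relaxed_objective r N g M"
  proof (rule coercive_minimizer_exists[OF g ninf _ _ norm_ge_zero[of N] closed_UNIV, where p = M0
        and q = "relaxed_quadratic r N"])
    show "continuous_on UNIV (relaxed_quadratic r N)"
      by (rule convex_on_continuous[OF open_UNIV convex_on_relaxed_quadratic[OF r]])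
    fix M :: "real ^ 'm ^ 'n"
    have "(norm M)\<^sup>2 \<le> (r_dual_norm r M)\<^sup>2"
      by (intro power_mono norm_le_r_dual_norm[OF r]) simp
    then show "(norm M)\<^sup>2 / 2 - norm N * norm M \<le> relaxed_quadratic r N M"
      using norm_cauchy_schwarz[of N M] by (simp add: relaxed_quadratic_def add_increasing2)
  qed (use M0 that in \<open>auto simp: relaxed\<close>)
  obtain \<gamma> where \<gamma>: "g Mc = ereal \<gamma>" using ninf[of Mc] Mc(1) by (cases "g Mc") auto
  define v where "v = relaxed_quadratic r N Mc + \<gamma>"
  have v: "relaxed_objective r N g Mc = ereal v" by (simp add: relaxed \<gamma> v_def)
  obtain D where D: "dual_objective r N g D \<le> ereal (- v)"
    using dual_value_attained[OF r g ninf] Mc(2) v by metis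
  have weak: "ereal (- v) \<le> dual_objective r N g D'" for D'
    using weak_duality[OF r, of N g Mc D'] by (simp add: v)
  have "is_min_on (rank_objective N g) {M. rank M \<le> r} (rank_objective N g Mp)"
    unfolding is_min_on_def using Mp by (intro imageI) (simp add: argmin)
  moreover have "is_min_on (dual_objective r N g) UNIV (ereal (- v))"
  proof -
    have "dual_objective r N g D = ereal (- v)" using D weak by (rule antisym)
    then show ?thesis
      unfolding is_min_on_def using weak by (intro image_eqI[of _ _ D]) (auto simp: argmin)
  qed
  moreover have "is_min_on (relaxed_objective r N g) UNIV (ereal v)"
    unfolding is_min_on_def using Mc(2) v by (intro image_eqI[of _ _ Mc]) (auto simp: argmin)
  moreover have "ereal v \<le> rank_objective N g Mp"
    using Mc(2)[of Mp] agree[OF Mp(1)] v by simp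
  moreover have "argmin_on (rank_objective N g) {M. rank M \<le> r}
      \<subseteq> argmin_on (relaxed_objective r N g) UNIV"
    if ex: "\<exists>M\<in>argmin_on (relaxed_objective r N g) UNIV. rank M \<le> r"
  proof
    fix M assume M: "M \<in> argmin_on (rank_objective N g) {M. rank M \<le> r}"
    obtain Ms where Ms: "rank Ms \<le> r" "\<And>M. relaxed_objective r N g Ms \<le> relaxed_objective r N g M"
      using ex by (auto simp: argmin)
    have "relaxed_objective r N g M \<le> relaxed_objective r N g Ms"
      using M Ms(1) by (auto simp: argmin agree)
    then show "M \<in> argmin_on (relaxed_objective r N g) UNIV"
      using Ms(2) order_trans by (auto simp: argmin)
  qed
  ultimately show ?thesis
    by (intro conjI impI exI[of _ "rank_objective N g Mp"] exI[of _ "ereal (- v)"] exI[of _ "ereal v"]) auto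
qed

end
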